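(* Let $D\subset\mathbb{R}^m$ be open and convex, let $F:D\to\mathbb{R}^m$ have continuous derivatives up to order four on $D$, and let $\alpha\in D$ satisfy $F(\alpha)=0$ with $F'(\alpha)$ nonsingular. For $x$ near $\alpha$ define $$y=x-[x+F(x),x-F(x);F]^{-1}F(x),\qquad z=y-\nu\,F(y),\qquad X=z-\nu\,F(z),$$ $$\nu=\bigl(2[y,x;F]-[x+F(x),x-F(x);F]\bigr)^{-1}.$$ Then the iterative method $x\mapsto X$ has local order of convergence at least six at $\alpha$. With $e=x-\alpha$, $\widetilde e=F'(\alpha)e$ and $$w=A_2\bigl(A_2(e,e),A_2(e,e)\bigr)-A_3\bigl(e,e,A_2(e,e)\bigr)-A_3\bigl(\widetilde e,\widetilde e,A_2(e,e)\bigr),$$ its vectorial error equation is, as $x\to\alpha$, $$X-\alpha=2A_2\bigl(A_2(e,e),w\bigr)-A_3(e,e,w)-A_3(\widetilde e,\widetilde e,w)+O(\|e\|^7).$$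
   Context: The first divided difference operator of $F$ is the matrix-valued map given by $[u,v;F]=\int_0^1F'(v+t(u-v))\,dt$ for $u,v\in D$ (by definition also when $u=v$). For $p=2,3$, $A_p=\frac1{p!}F'(\alpha)^{-1}F^{(p)}(\alpha)$, a symmetric $p$-linear map $(\mathbb{R}^m)^p\to\mathbb{R}^m$. For $x$ sufficiently close to $\alpha$, all the points involved lie in $D$ and all the inverses involved exist. An iterative method $x_{n+1}=\Phi(x_n)$ has local order of convergence at least $p$ at $\alpha$ if, for $x_0$ sufficiently close to $\alpha$, the iterates are well defined and converge to $\alpha$, and there is a constant $C$ with $\|x_{n+1}-\alpha\|\le C\|x_n-\alpha\|^p$ for all $n$. *)

theory Defs
  imports "HOL-Analysis.Analysis" "HOL-Library.Landau_Symbols"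
begin

(* fderiv (fderiv f) x, fderiv (fderiv (fderiv f)) x, ... are the second, third, ... derivatives
   of f at x as nested bounded linear maps: f''(x)(u,v) is "fderiv (fderiv f) x u v".
   Where f is not differentiable the value is unspecified. *)
definition fderiv ::
    "('a::real_normed_vector \<Rightarrow> 'b::real_normed_vector) \<Rightarrow> 'a \<Rightarrow> 'a \<Rightarrow>\<^sub>L 'b" where
  "fderiv f x = Blinfun (frechet_derivative f (at x))"

(* Intended for open S. Continuity of the derivatives of order less than four follows from
   their differentiability. *)
definition C4_on ::
    "'a::real_normed_vector set \<Rightarrow> ('a \<Rightarrow> 'b::real_normed_vector) \<Rightarrow> bool" where
  "C4_on S f \<longleftrightarrow>
     (\<forall>x\<in>S. f differentiable (at x) \<and>
            fderiv f differentiable (at x) \<and>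
            fderiv (fderiv f) differentiable (at x) \<and>
            fderiv (fderiv (fderiv f)) differentiable (at x)) \<and>
     continuous_on S (fderiv (fderiv (fderiv (fderiv f))))"

definition A2 :: "(real^'m \<Rightarrow> real^'m) \<Rightarrow> real^'m \<Rightarrow> real^'m \<Rightarrow> real^'m \<Rightarrow> real^'m" where
  "A2 F \<alpha> u v = (1 / fact 2) *\<^sub>R
     (matrix_inv (jacobian F (at \<alpha>)) *v blinfun_apply (blinfun_apply (fderiv (fderiv F) \<alpha>) u) v)"

definition A3 :: "(real^'m \<Rightarrow> real^'m) \<Rightarrow> real^'m \<Rightarrow> real^'m \<Rightarrow> real^'m \<Rightarrow> real^'m \<Rightarrow> real^'m" where
  "A3 F \<alpha> u v w = (1 / fact 3) *\<^sub>R
     (matrix_inv (jacobian F (at \<alpha>)) *v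
        blinfun_apply (blinfun_apply (blinfun_apply (fderiv (fderiv (fderiv F)) \<alpha>) u) v) w)"

definition divdiff :: "(real^'m \<Rightarrow> real^'m) \<Rightarrow> real^'m \<Rightarrow> real^'m \<Rightarrow> real^'m^'m" where
  "divdiff F u v = integral {0..1} (\<lambda>t::real. jacobian F (at (v + t *\<^sub>R (u - v))))"

definition step_y :: "(real^'m \<Rightarrow> real^'m) \<Rightarrow> real^'m \<Rightarrow> real^'m" where
  "step_y F x = x - matrix_inv (divdiff F (x + F x) (x - F x)) *v F x"

(* the matrix whose inverse is \<nu> *)
definition step_M :: "(real^'m \<Rightarrow> real^'m) \<Rightarrow> real^'m \<Rightarrow> real^'m^'m" where
  "step_M F x = 2 *\<^sub>R divdiff F (step_y F x) x - divdiff F (x + F x) (x - F x)"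

definition step_nu :: "(real^'m \<Rightarrow> real^'m) \<Rightarrow> real^'m \<Rightarrow> real^'m^'m" where
  "step_nu F x = matrix_inv (step_M F x)"

definition step_z :: "(real^'m \<Rightarrow> real^'m) \<Rightarrow> real^'m \<Rightarrow> real^'m" where
  "step_z F x = step_y F x - step_nu F x *v F (step_y F x)"

definition step_X :: "(real^'m \<Rightarrow> real^'m) \<Rightarrow> real^'m \<Rightarrow> real^'m" where
  "step_X F x = step_z F x - step_nu F x *v F (step_z F x)"

(* The points at which one step is meaningful: F is evaluated only inside D and only nonsingular
   matrices are inverted. *)
definition step_domain :: "(real^'m) set \<Rightarrow> (real^'m \<Rightarrow> real^'m) \<Rightarrow> (real^'m) set" where
  "step_domain D F = {x. x \<in> D \<and> x + F x \<in> D \<and> x - F x \<in> D \<and>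
     invertible (divdiff F (x + F x) (x - F x)) \<and> step_y F x \<in> D \<and>
     invertible (step_M F x) \<and> step_z F x \<in> D}"

(* S is the domain of the partially defined iteration map \<Phi>; the iterates from x0 are well
   defined iff they all lie in S. The constant C does not depend on x0. *)
definition local_order_at_least ::
    "nat \<Rightarrow> 'a::real_normed_vector set \<Rightarrow> ('a \<Rightarrow> 'a) \<Rightarrow> 'a \<Rightarrow> bool" where
  "local_order_at_least p S \<Phi> \<alpha> \<longleftrightarrow>
     (\<exists>C. \<forall>\<^sub>F x0 in nhds \<alpha>.
        (\<forall>n. (\<Phi> ^^ n) x0 \<in> S) \<and>
        (\<lambda>n. (\<Phi> ^^ n) x0) \<longlonglongrightarrow> \<alpha> \<and>
        (\<forall>n. norm ((\<Phi> ^^ Suc n) x0 - \<alpha>) \<le> C * norm ((\<Phi> ^^ n) x0 - \<alpha>) ^ p))"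

end

theory Submission
  imports Defs
begin

text \<open>Write $L = F'(\alpha)$, $e = x - \alpha$, $B = [x+F(x),x-F(x);F]$ and $M = 2[y,x;F] - B$. Every substep of the
method has the form $p \mapsto p - N^{-1}F(p)$ with $N \in \{B, M\}$ close to $L$, and its new error
satisfies
\[ N\,(p - N^{-1}F(p) - \alpha) = N(p-\alpha) - F(p). \]
The gain of order in a substep is thus governed by how well $N(p-\alpha)$ reproduces $F(p)$, that is,
by the expansions of $N$ and of $F$.

Averaging the Taylor expansion of $F'$ along a segment gives
(lemma \<open>divdiff_expansion\<close>), with $Q(u)v = L A_2(u,v)$ and $T(u,v)w = L A_3(u,v,w)$,
\[ [\alpha+p,\alpha+q;F] = L + Q(p+q) + T(p,p) + T(q,q) + \tfrac12\bigl(T(p,q)+T(q,p)\bigr) + O(3), \]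
where $O(n)$ stands for $O(\|e\|^n)$ and $p$, $q$ are assumed to be of size $O(\|e\|)$. Consequently
$B = L + 2Q(e) + 3T(e,e) + T(\widetilde e,\widetilde e) + O(3)$. Since
$F(x) = Le + Q(e)e + O(3)$, it follows that $Be - F(x) = Q(e)e + O(3)$, and the first substep converges
quadratically: $y - \alpha = a + O(3)$ with $a = A_2(e,e)$. In $M$ the
linear terms in $e$ cancel, which leaves $M = L + K + O(3)$ with
$K = 2Q(a) - T(e,e) - T(\widetilde e,\widetilde e)$ of order two. Hence each of the last two substeps gains
two orders:
\[ L(z-\alpha) = Ka - Q(a)a + O(5) = Lw + O(5), \qquad L(X-\alpha) = K(z-\alpha) + O(7) = Kw + O(7), \]
and $L^{-1}Kw$ is the vectorial error in the claim. The argument is made rigorous without expanding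
any inverse: the lemma \<open>newton_like_correction\<close> only uses that matrices near $L$ are bounded below.
The sixth-order bound on $X - \alpha$ then yields the local order, because such a map contracts a small
ball around $\alpha$.\<close>

section \<open>Orders of vanishing\<close>

text \<open>The relation $f(x) = O(\|x-\alpha\|^n)$ for vector-valued $f$. The filter is the full
neighbourhood filter, so the bound also holds at $\alpha$ itself; this is what lets such a
relation be composed with maps that may take the value $\alpha$.\<close>

definition vanishes :: "'a::real_normed_vector \<Rightarrow> nat \<Rightarrow> ('a \<Rightarrow> 'b::real_normed_vector) \<Rightarrow> bool" where
  "vanishes \<alpha> n f \<longleftrightarrow> (\<exists>C. \<forall>\<^sub>F x in nhds \<alpha>. norm (f x) \<le> C * norm (x - \<alpha>) ^ n)"

lemma vanishesI:
  assumes "\<forall>\<^sub>F x in nhds \<alpha>. norm (f x) \<le> C * norm (x - \<alpha>) ^ n"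
  shows "vanishes \<alpha> n f"
  using assms by (auto simp: vanishes_def)

lemma vanishesE:
  assumes "vanishes \<alpha> n f"
  obtains C where "C > 0" "\<forall>\<^sub>F x in nhds \<alpha>. norm (f x) \<le> C * norm (x - \<alpha>) ^ n"
proof -
  obtain C where C: "\<forall>\<^sub>F x in nhds \<alpha>. norm (f x) \<le> C * norm (x - \<alpha>) ^ n"
    using assms by (auto simp: vanishes_def)
  show thesis
  proof (rule that)
    show "\<bar>C\<bar> + 1 > 0" by simp
    show "\<forall>\<^sub>F x in nhds \<alpha>. norm (f x) \<le> (\<bar>C\<bar> + 1) * norm (x - \<alpha>) ^ n"
      using C by eventually_elim (erule order_trans, rule mult_right_mono, auto)
  qed
qed

lemma eventually_norm_diff_less:
  fixes \<alpha> :: "'a::real_normed_vector"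
  assumes "r > 0"
  shows "\<forall>\<^sub>F x in nhds \<alpha>. norm (x - \<alpha>) < r"
  using assms by (auto simp: eventually_nhds_metric dist_norm)

lemma vanishes_mono:
  assumes "vanishes \<alpha> n f" and "m \<le> n"
  shows "vanishes \<alpha> m f"
proof -
  obtain C where C: "C > 0" "\<forall>\<^sub>F x in nhds \<alpha>. norm (f x) \<le> C * norm (x - \<alpha>) ^ n"
    using vanishesE[OF assms(1)] .
  show ?thesis
  proof (rule vanishesI)
    show "\<forall>\<^sub>F x in nhds \<alpha>. norm (f x) \<le> C * norm (x - \<alpha>) ^ m"
      using C(2) eventually_norm_diff_less[OF zero_less_one, of \<alpha>]
    proof eventually_elim
      case (elim x)
      have "norm (x - \<alpha>) ^ n \<le> norm (x - \<alpha>) ^ m"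
        using elim assms(2) by (intro power_decreasing) auto
      then show ?case
        using elim(1) C(1) by (meson mult_left_mono less_imp_le order_trans)
    qed
  qed
qed

lemma vanishes_self: "vanishes \<alpha> 1 (\<lambda>x. x - \<alpha>)"
  by (rule vanishesI[where C = 1]) simp

lemma vanishes_add:
  assumes "vanishes \<alpha> n f" and "vanishes \<alpha> n g"
  shows "vanishes \<alpha> n (\<lambda>x. f x + g x)"
proof -
  obtain C where C: "\<forall>\<^sub>F x in nhds \<alpha>. norm (f x) \<le> C * norm (x - \<alpha>) ^ n"
    using vanishesE[OF assms(1)] .
  obtain E where E: "\<forall>\<^sub>F x in nhds \<alpha>. norm (g x) \<le> E * norm (x - \<alpha>) ^ n"
    using vanishesE[OF assms(2)] .
  show ?thesis
  proof (rule vanishesI)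
    show "\<forall>\<^sub>F x in nhds \<alpha>. norm (f x + g x) \<le> (C + E) * norm (x - \<alpha>) ^ n"
      using C E by eventually_elim (auto simp: algebra_simps intro: norm_triangle_le)
  qed
qed

lemma vanishes_bounded_linear:
  assumes "bounded_linear h" and "vanishes \<alpha> n f"
  shows "vanishes \<alpha> n (\<lambda>x. h (f x))"
proof -
  obtain K where K: "K > 0" "\<And>y. norm (h y) \<le> norm y * K"
    using bounded_linear.pos_bounded[OF assms(1)] by auto
  obtain C where C: "\<forall>\<^sub>F x in nhds \<alpha>. norm (f x) \<le> C * norm (x - \<alpha>) ^ n"
    using vanishesE[OF assms(2)] .
  show ?thesis
  proof (rule vanishesI)
    show "\<forall>\<^sub>F x in nhds \<alpha>. norm (h (f x)) \<le> (K * C) * norm (x - \<alpha>) ^ n"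
      using C
    proof eventually_elim
      case (elim x)
      have "norm (h (f x)) \<le> norm (f x) * K" by (rule K(2))
      also have "\<dots> \<le> (C * norm (x - \<alpha>) ^ n) * K"
        using elim K(1) by (intro mult_right_mono) auto
      finally show ?case by (simp add: mult_ac)
    qed
  qed
qed

lemma vanishes_minus: "vanishes \<alpha> n f \<Longrightarrow> vanishes \<alpha> n (\<lambda>x. - f x)"
  by (rule vanishes_bounded_linear[OF bounded_linear_minus[OF bounded_linear_ident]])

lemma vanishes_scaleR: "vanishes \<alpha> n f \<Longrightarrow> vanishes \<alpha> n (\<lambda>x. c *\<^sub>R f x)"
  by (rule vanishes_bounded_linear[OF bounded_linear_scaleR_right])

lemma vanishes_diff:
  assumes "vanishes \<alpha> n f" and "vanishes \<alpha> n g"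
  shows "vanishes \<alpha> n (\<lambda>x. f x - g x)"
  using vanishes_add[OF assms(1) vanishes_minus[OF assms(2)]] by simp

text \<open>The target order $k$ is left free below $m + n$, so that one rule both multiplies orders and
discards the surplus.\<close>

lemma vanishes_bilinear:
  assumes "bounded_bilinear h" and "vanishes \<alpha> m f" and "vanishes \<alpha> n g" and "k \<le> m + n"
  shows "vanishes \<alpha> k (\<lambda>x. h (f x) (g x))"
proof -
  obtain K where K: "K > 0" "\<And>y z. norm (h y z) \<le> norm y * norm z * K"
    using bounded_bilinear.pos_bounded[OF assms(1)] by auto
  obtain C where C: "C > 0" "\<forall>\<^sub>F x in nhds \<alpha>. norm (f x) \<le> C * norm (x - \<alpha>) ^ m"
    using vanishesE[OF assms(2)] .
  obtain E where E: "E > 0" "\<forall>\<^sub>F x in nhds \<alpha>. norm (g x) \<le> E * norm (x - \<alpha>) ^ n"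
    using vanishesE[OF assms(3)] .
  have "vanishes \<alpha> (m + n) (\<lambda>x. h (f x) (g x))"
  proof (rule vanishesI)
    show "\<forall>\<^sub>F x in nhds \<alpha>. norm (h (f x) (g x)) \<le> (C * E * K) * norm (x - \<alpha>) ^ (m + n)"
      using C(2) E(2)
    proof eventually_elim
      case (elim x)
      have "norm (h (f x) (g x)) \<le> norm (f x) * norm (g x) * K" by (rule K(2))
      also have "\<dots> \<le> (C * norm (x - \<alpha>) ^ m) * (E * norm (x - \<alpha>) ^ n) * K"
        using elim C(1) E(1) K(1) by (intro mult_right_mono mult_mono) auto
      finally show ?case by (simp add: power_add mult_ac)
    qed
  qed
  then show ?thesis using assms(4) by (rule vanishes_mono)
qed

lemma vanishes_imp_tendsto:
  assumes "vanishes \<alpha> n f" and "n \<ge> 1"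
  shows "(f \<longlongrightarrow> 0) (nhds \<alpha>)"
proof -
  obtain C where C: "\<forall>\<^sub>F x in nhds \<alpha>. norm (f x) \<le> C * norm (x - \<alpha>) ^ 1"
    using vanishesE[OF vanishes_mono[OF assms]] .
  have "((\<lambda>x. C * norm (x - \<alpha>) ^ 1) \<longlongrightarrow> C * norm (\<alpha> - \<alpha>) ^ 1) (nhds \<alpha>)"
    by (intro tendsto_intros filterlim_ident)
  then show ?thesis
    using C by (intro Lim_null_comparison[of f "\<lambda>x. C * norm (x - \<alpha>) ^ 1"]) auto
qed

lemma vanishes_compose:
  assumes "vanishes \<alpha> n f" and "vanishes \<alpha> k (\<lambda>x. p x - \<alpha>)" and "k \<ge> 1"
  shows "vanishes \<alpha> (k * n) (\<lambda>x. f (p x))"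
proof -
  obtain C where C: "C > 0" "\<forall>\<^sub>F x in nhds \<alpha>. norm (f x) \<le> C * norm (x - \<alpha>) ^ n"
    using vanishesE[OF assms(1)] .
  obtain E where E: "\<forall>\<^sub>F x in nhds \<alpha>. norm (p x - \<alpha>) \<le> E * norm (x - \<alpha>) ^ k"
    using vanishesE[OF assms(2)] .
  have "(p \<longlongrightarrow> \<alpha>) (nhds \<alpha>)"
    using vanishes_imp_tendsto[OF assms(2,3)] by (simp add: LIM_zero_iff)
  then have "\<forall>\<^sub>F x in nhds \<alpha>. norm (f (p x)) \<le> C * norm (p x - \<alpha>) ^ n"
    using eventually_compose_filterlim[OF C(2)] by blast
  with E have "\<forall>\<^sub>F x in nhds \<alpha>. norm (f (p x)) \<le> (C * E ^ n) * norm (x - \<alpha>) ^ (k * n)"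
  proof eventually_elim
    case (elim x)
    have "C * norm (p x - \<alpha>) ^ n \<le> C * (E * norm (x - \<alpha>) ^ k) ^ n"
      using elim(1) C(1) by (intro mult_left_mono power_mono) auto
    then show ?case using elim(2) by (simp add: power_mult_distrib power_mult mult_ac)
  qed
  then show ?thesis by (rule vanishesI)
qed

section \<open>Matrices close to a nonsingular matrix\<close>

lemma bounded_bilinear_matrix_vector_mult:
  "bounded_bilinear ((*v) :: real^'n^'m \<Rightarrow> real^'n \<Rightarrow> real^'m)"
  by (simp add: bilinear_conv_bounded_bilinear[symmetric] bilinear_def linear_iff
      matrix_vector_mult_add_rdistrib matrix_vector_right_distrib
      scaleR_matrix_vector_assoc[symmetric] matrix_vector_mult_scaleR)

lemma matrix_inv_inverse:
  fixes A :: "real^'n^'n"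
  assumes "invertible A"
  shows "A *v (matrix_inv A *v v) = v" and "matrix_inv A *v (A *v v) = v"
proof -
  have *: "A ** matrix_inv A = mat 1 \<and> matrix_inv A ** A = mat 1"
    using assms unfolding invertible_def matrix_inv_def by (rule someI_ex)
  then show "A *v (matrix_inv A *v v) = v" "matrix_inv A *v (A *v v) = v"
    by (simp_all add: matrix_vector_mul_assoc)
qed

text \<open>A nonsingular $L$ satisfies $c\|v\| \le \|Lv\|$ for some $c > 0$, and a perturbation of norm
small compared to $c$ costs at most half of this. The uniform lower bound gives both the
existence of the inverses and their boundedness, without expanding any inverse in a series.\<close>

lemma eventually_bounded_below:
  fixes L :: "real^'n^'n"
  assumes "invertible L" and "vanishes \<alpha> 1 (\<lambda>x. N x - L)"
  obtains c where "c > 0" "\<forall>\<^sub>F x in nhds \<alpha>. \<forall>v. c * norm v \<le> norm (N x *v v)"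
proof -
  have inj: "inj ((*v) L)"
    by (metis injI matrix_inv_inverse(2)[OF assms(1)])
  obtain c where c: "c > 0" "\<And>v. c * norm v \<le> norm (L *v v)"
    using linear_inj_bounded_below_pos[OF _ inj] by (metis matrix_vector_mul_linear mult.commute)
  obtain K where K: "K > 0" "\<And>A v. norm ((A::real^'n^'n) *v v) \<le> norm A * norm v * K"
    using bounded_bilinear.pos_bounded[OF bounded_bilinear_matrix_vector_mult] by auto
  have "((\<lambda>x. N x - L) \<longlongrightarrow> 0) (nhds \<alpha>)"
    by (rule vanishes_imp_tendsto[OF assms(2)]) simp
  then have "\<forall>\<^sub>F x in nhds \<alpha>. dist (N x - L) 0 < c / (2 * K)"
    by (rule tendstoD) (use c K in simp)
  then have "\<forall>\<^sub>F x in nhds \<alpha>. \<forall>v. c / 2 * norm v \<le> norm (N x *v v)"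
  proof eventually_elim
    case (elim x)
    show ?case
    proof
      fix v
      have "norm ((N x - L) *v v) \<le> norm (N x - L) * norm v * K" by (rule K(2))
      also have "\<dots> \<le> c / (2 * K) * norm v * K"
        using elim K(1) by (intro mult_right_mono) (auto simp: dist_norm)
      finally have "norm ((N x - L) *v v) \<le> c / 2 * norm v" using K(1) by simp
      moreover have "L *v v = N x *v v - (N x - L) *v v"
        by (simp add: matrix_vector_mult_diff_rdistrib)
      then have "norm (L *v v) \<le> norm (N x *v v) + norm ((N x - L) *v v)"
        by (metis norm_triangle_ineq4)
      ultimately show "c / 2 * norm v \<le> norm (N x *v v)" using c(2)[of v] by linarith
    qed
  qed
  then show thesis using c(1) that[of "c / 2"] by simp
qed

lemma eventually_invertible:
  fixes L :: "real^'n^'n"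
  assumes "invertible L" and "vanishes \<alpha> 1 (\<lambda>x. N x - L)"
  shows "\<forall>\<^sub>F x in nhds \<alpha>. invertible (N x)"
proof -
  obtain c where c: "c > 0" "\<forall>\<^sub>F x in nhds \<alpha>. \<forall>v. c * norm v \<le> norm (N x *v v)"
    using eventually_bounded_below[OF assms] .
  show ?thesis using c(2)
  proof eventually_elim
    case (elim x)
    have "inj ((*v) (N x))"
    proof (rule injI)
      fix u v assume "N x *v u = N x *v v"
      then have "N x *v (u - v) = 0" by (simp add: matrix_vector_mult_diff_distrib)
      then have "c * norm (u - v) \<le> 0" using elim by (metis norm_zero)
      then show "u = v" using c(1) by (simp add: mult_le_0_iff)
    qed
    then show ?case by (simp add: invertible_left_inverse matrix_left_invertible_injective)
  qed
qed

lemma vanishes_cancel_matrix: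
  fixes L :: "real^'n^'n"
  assumes "invertible L" and "vanishes \<alpha> 1 (\<lambda>x. N x - L)"
    and "vanishes \<alpha> n (\<lambda>x. N x *v g x)"
  shows "vanishes \<alpha> n g"
proof -
  obtain c where c: "c > 0" "\<forall>\<^sub>F x in nhds \<alpha>. \<forall>v. c * norm v \<le> norm (N x *v v)"
    using eventually_bounded_below[OF assms(1,2)] .
  obtain C where C: "\<forall>\<^sub>F x in nhds \<alpha>. norm (N x *v g x) \<le> C * norm (x - \<alpha>) ^ n"
    using vanishesE[OF assms(3)] .
  show ?thesis
  proof (rule vanishesI)
    show "\<forall>\<^sub>F x in nhds \<alpha>. norm (g x) \<le> (C / c) * norm (x - \<alpha>) ^ n"
      using c(2) C
    proof eventually_elim
      case (elim x)
      then have "c * norm (g x) \<le> C * norm (x - \<alpha>) ^ n" by (meson order_trans)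
      then show ?case using c(1) by (simp add: field_simps)
    qed
  qed
qed

lemma vanishes_cong:
  assumes "\<forall>\<^sub>F x in nhds \<alpha>. f x = g x" and "vanishes \<alpha> n f"
  shows "vanishes \<alpha> n g"
proof -
  obtain C where C: "\<forall>\<^sub>F x in nhds \<alpha>. norm (f x) \<le> C * norm (x - \<alpha>) ^ n"
    using vanishesE[OF assms(2)] .
  show ?thesis
    by (rule vanishesI[of _ C]) (use assms(1) C in eventually_elim, simp)
qed

text \<open>The error estimate behind all three substeps. Each of them has the form
$p \mapsto p - N^{-1}F(p)$ with $N$ close to $L$. If $t$ is the conjectured leading part of the
new error, multiplying by $N$ gives
\[ N(p - N^{-1}F(p) - \alpha - t) = \bigl(N(p-\alpha) - F(p) - Lt\bigr) - (N - L)t, \]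
and $N^{-1}$ is bounded, so the conjecture is confirmed to order $n$ by two estimates that
mention no inverse.\<close>

lemma newton_like_correction:
  fixes L :: "real^'n^'n"
  assumes "invertible L" and N: "vanishes \<alpha> 1 (\<lambda>x. N x - L)"
    and defect: "vanishes \<alpha> n (\<lambda>x. N x *v (p x - \<alpha>) - F (p x) - L *v t x)"
    and "vanishes \<alpha> n (\<lambda>x. (N x - L) *v t x)"
  shows "vanishes \<alpha> n (\<lambda>x. p x - matrix_inv (N x) *v F (p x) - \<alpha> - t x)"
proof (rule vanishes_cancel_matrix[OF assms(1) N])
  have "vanishes \<alpha> n (\<lambda>x. (N x *v (p x - \<alpha>) - F (p x) - L *v t x) - (N x - L) *v t x)"
    by (intro vanishes_diff assms)
  moreover have "\<forall>\<^sub>F x in nhds \<alpha>.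
      (N x *v (p x - \<alpha>) - F (p x) - L *v t x) - (N x - L) *v t x =
      N x *v (p x - matrix_inv (N x) *v F (p x) - \<alpha> - t x)"
    using eventually_invertible[OF assms(1) N]
  proof eventually_elim
    case (elim x)
    then show ?case
      by (simp add: matrix_vector_mult_diff_distrib matrix_vector_mult_diff_rdistrib
          matrix_inv_inverse(1))
  qed
  ultimately show "vanishes \<alpha> n (\<lambda>x. N x *v (p x - matrix_inv (N x) *v F (p x) - \<alpha> - t x))"
    by (rule vanishes_cong[rotated])
qed

section \<open>Local order of convergence\<close>

text \<open>A map whose error is $O(\|x-\alpha\|^p)$ with $p \ge 2$ halves the distance to $\alpha$ on a small
ball. The iterates therefore stay in that ball, where the error bound keeps holding, and they
converge geometrically.\<close>

lemma local_order_if_vanishes: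
  assumes S: "\<forall>\<^sub>F x in nhds \<alpha>. x \<in> S" and "vanishes \<alpha> p (\<lambda>x. \<Phi> x - \<alpha>)" and "p \<ge> 2"
  shows "local_order_at_least p S \<Phi> \<alpha>"
proof -
  obtain C where C: "C > 0" "\<forall>\<^sub>F x in nhds \<alpha>. norm (\<Phi> x - \<alpha>) \<le> C * norm (x - \<alpha>) ^ p"
    using vanishesE[OF assms(2)] .
  obtain c where c: "c > 0" "\<forall>\<^sub>F x in nhds \<alpha>. norm (\<Phi> x - \<alpha>) \<le> c * norm (x - \<alpha>) ^ 2"
    using vanishesE[OF vanishes_mono[OF assms(2,3)]] .
  have "\<forall>\<^sub>F x in nhds \<alpha>. norm (x - \<alpha>) < 1 / (2 * c)"
    using c(1) by (intro eventually_norm_diff_less) simp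
  with c(2) have "\<forall>\<^sub>F x in nhds \<alpha>. norm (\<Phi> x - \<alpha>) \<le> norm (x - \<alpha>) / 2"
  proof eventually_elim
    case (elim x)
    have "c * norm (x - \<alpha>) ^ 2 = (c * norm (x - \<alpha>)) * norm (x - \<alpha>)"
      by (simp add: power2_eq_square)
    also have "\<dots> \<le> (1 / 2) * norm (x - \<alpha>)"
      using elim(2) c(1) by (intro mult_right_mono) (auto simp: field_simps)
    finally show ?case using elim(1) by simp
  qed
  with S C(2) have "\<forall>\<^sub>F x in nhds \<alpha>. x \<in> S \<and> norm (\<Phi> x - \<alpha>) \<le> C * norm (x - \<alpha>) ^ p \<and>
      norm (\<Phi> x - \<alpha>) \<le> norm (x - \<alpha>) / 2"
    by eventually_elim auto
  then obtain r where r: "r > 0" and good: "\<And>x. norm (x - \<alpha>) < r \<Longrightarrow> x \<in> S \<and>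
      norm (\<Phi> x - \<alpha>) \<le> C * norm (x - \<alpha>) ^ p \<and> norm (\<Phi> x - \<alpha>) \<le> norm (x - \<alpha>) / 2"
    by (auto simp: eventually_nhds_metric dist_norm)
  have "(\<forall>n. (\<Phi> ^^ n) x0 \<in> S) \<and> (\<lambda>n. (\<Phi> ^^ n) x0) \<longlonglongrightarrow> \<alpha> \<and>
      (\<forall>n. norm ((\<Phi> ^^ Suc n) x0 - \<alpha>) \<le> C * norm ((\<Phi> ^^ n) x0 - \<alpha>) ^ p)"
    if x0: "norm (x0 - \<alpha>) < r" for x0
  proof -
    have bound: "norm ((\<Phi> ^^ n) x0 - \<alpha>) < r \<and>
        norm ((\<Phi> ^^ n) x0 - \<alpha>) \<le> (1 / 2) ^ n * norm (x0 - \<alpha>)" for n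
    proof (induction n)
      case 0
      then show ?case using x0 by simp
    next
      case (Suc n)
      then have "norm (\<Phi> ((\<Phi> ^^ n) x0) - \<alpha>) \<le> norm ((\<Phi> ^^ n) x0 - \<alpha>) / 2"
        using good by blast
      then have "norm (\<Phi> ((\<Phi> ^^ n) x0) - \<alpha>) < r \<and>
          norm (\<Phi> ((\<Phi> ^^ n) x0) - \<alpha>) \<le> ((1 / 2) ^ n * norm (x0 - \<alpha>)) / 2"
        using Suc norm_ge_zero[of "(\<Phi> ^^ n) x0 - \<alpha>"] by linarith
      then show ?case by simp
    qed
    have "(\<lambda>n. (\<Phi> ^^ n) x0 - \<alpha>) \<longlonglongrightarrow> 0"
    proof (rule Lim_null_comparison)
      show "\<forall>\<^sub>F n in sequentially.
          norm ((\<Phi> ^^ n) x0 - \<alpha>) \<le> (1 / 2) ^ n * norm (x0 - \<alpha>)"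
        using bound by simp
      show "(\<lambda>n. (1 / 2) ^ n * norm (x0 - \<alpha>)) \<longlonglongrightarrow> 0"
        by (intro tendsto_mult_left_zero LIMSEQ_realpow_zero) auto
    qed
    then show ?thesis using bound good by (simp add: LIM_zero_iff)
  qed
  then show ?thesis
    unfolding local_order_at_least_def
    by (intro exI[of _ C] eventually_mono[OF eventually_norm_diff_less[OF r]]) blast
qed

section \<open>Taylor expansion of the derivative\<close>

text \<open>The derivatives are bounded linear maps, the divided differences are matrices; the expansions are
made for the former and transported by this bounded linear map.\<close>

definition matrix_of_blinfun :: "(real^'n) \<Rightarrow>\<^sub>L (real^'m) \<Rightarrow> real^'n^'m" where
  "matrix_of_blinfun A = matrix (blinfun_apply A)"

lemma matrix_of_blinfun_mult [simp]: "matrix_of_blinfun A *v v = blinfun_apply A v"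
  by (simp add: matrix_of_blinfun_def matrix_works bounded_linear.linear[OF blinfun.bounded_linear_right])

lemma bounded_linear_matrix_of_blinfun:
  "bounded_linear (matrix_of_blinfun :: ((real^'n) \<Rightarrow>\<^sub>L (real^'m)) \<Rightarrow> _)"
proof (rule bounded_linear_intro)
  fix A B :: "(real^'n) \<Rightarrow>\<^sub>L (real^'m)" and r :: real
  show "matrix_of_blinfun (A + B) = matrix_of_blinfun A + matrix_of_blinfun B"
    "matrix_of_blinfun (r *\<^sub>R A) = r *\<^sub>R matrix_of_blinfun A"
    by (simp_all add: matrix_of_blinfun_def matrix_def vec_eq_iff blinfun.bilinear_simps)
  have entry: "\<bar>matrix_of_blinfun A $ i $ j\<bar> \<le> norm A" for i j
  proof -
    have "\<bar>matrix_of_blinfun A $ i $ j\<bar> \<le> norm (blinfun_apply A (axis j 1))"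
      by (simp add: matrix_of_blinfun_def matrix_def component_le_norm_cart)
    also have "\<dots> \<le> norm A"
      using norm_blinfun[of A "axis j 1"] by simp
    finally show ?thesis .
  qed
  have "norm (matrix_of_blinfun A) \<le> (\<Sum>i\<in>UNIV. norm (matrix_of_blinfun A $ i))"
    by (simp add: norm_vec_def L2_set_le_sum)
  also have "\<dots> \<le> (\<Sum>i\<in>UNIV. \<Sum>j\<in>UNIV. \<bar>matrix_of_blinfun A $ i $ j\<bar>)"
    by (intro sum_mono norm_le_l1_cart)
  also have "\<dots> \<le> (\<Sum>i\<in>(UNIV::'m set). \<Sum>j\<in>(UNIV::'n set). norm A)"
    by (intro sum_mono entry)
  finally show "norm (matrix_of_blinfun A) \<le> norm A * (real CARD('m) * real CARD('n))"
    by (simp add: mult_ac)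
qed

lemma norm_increment_le:
  fixes g :: "real \<Rightarrow> 'b::real_normed_vector"
  assumes "\<And>t. t \<in> {0..1} \<Longrightarrow> (g has_vector_derivative g' t) (at t)"
    and "\<And>t. t \<in> {0..1} \<Longrightarrow> norm (g' t) \<le> K"
  shows "norm (g 1 - g 0) \<le> K"
proof -
  have "norm (g 1 - g 0) \<le> K * norm (1 - 0 :: real)"
  proof (rule differentiable_bound[of "{0..1}"])
    show "(g has_derivative (\<lambda>h. h *\<^sub>R g' t)) (at t within {0..1})" if "t \<in> {0..1}" for t
      using assms(1)[OF that] has_derivative_at_withinI
      unfolding has_vector_derivative_def by blast
    show "onorm (\<lambda>h. h *\<^sub>R g' t) \<le> K" if "t \<in> {0..1}" for t
      using assms(2)[OF that] by (intro onorm_le) (auto simp: mult.commute[of K] intro: mult_left_mono)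
  qed auto
  then show ?thesis by simp
qed

text \<open>An expansion of the derivative integrates to an expansion of the function. The comparison is made
along the segment from $\alpha$ to $\alpha + h$, as functions of one real variable $t$: there
$t A h + \frac{t^2}{2} B(h,h)$ has derivative $(A + B(th))h$, which is the expansion of $f'(\alpha+th)h$.\<close>

lemma taylor_from_derivative:
  fixes f :: "'a::real_normed_vector \<Rightarrow> 'b::real_normed_vector"
    and A :: "'a \<Rightarrow>\<^sub>L 'b" and B :: "'a \<Rightarrow>\<^sub>L 'a \<Rightarrow>\<^sub>L 'b"
  assumes deriv: "\<forall>\<^sub>F p in nhds \<alpha>. (f has_derivative blinfun_apply (f' p)) (at p)"
    and f': "vanishes \<alpha> n (\<lambda>p. f' p - A - blinfun_apply B (p - \<alpha>))"
  shows "vanishes \<alpha> (Suc n)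
    (\<lambda>p. f p - f \<alpha> - blinfun_apply A (p - \<alpha>)
         - (1/2) *\<^sub>R blinfun_apply (blinfun_apply B (p - \<alpha>)) (p - \<alpha>))"
proof -
  obtain C where C: "C > 0" "\<forall>\<^sub>F p in nhds \<alpha>.
      norm (f' p - A - blinfun_apply B (p - \<alpha>)) \<le> C * norm (p - \<alpha>) ^ n"
    using vanishesE[OF f'] .
  have "\<forall>\<^sub>F p in nhds \<alpha>. (f has_derivative blinfun_apply (f' p)) (at p) \<and>
      norm (f' p - A - blinfun_apply B (p - \<alpha>)) \<le> C * norm (p - \<alpha>) ^ n"
    using deriv C(2) by eventually_elim simp
  then obtain r where r: "r > 0" and good: "\<And>p. norm (p - \<alpha>) < r \<Longrightarrow>
      (f has_derivative blinfun_apply (f' p)) (at p) \<and>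
      norm (f' p - A - blinfun_apply B (p - \<alpha>)) \<le> C * norm (p - \<alpha>) ^ n"
    by (auto simp: eventually_nhds_metric dist_norm)
  show ?thesis
  proof (rule vanishesI, rule eventually_mono[OF eventually_norm_diff_less[OF r]])
    fix p assume p: "norm (p - \<alpha>) < r"
    define h where "h = p - \<alpha>"
    \<comment> \<open>the difference between f and its claimed expansion on the segment, and its derivative in t\<close>
    define g where "g t = f (\<alpha> + t *\<^sub>R h) - (t *\<^sub>R blinfun_apply A h
        + (t\<^sup>2 / 2) *\<^sub>R blinfun_apply (blinfun_apply B h) h)" for t
    define g' where "g' t = blinfun_apply (f' (\<alpha> + t *\<^sub>R h)) h - (blinfun_apply A h
        + t *\<^sub>R blinfun_apply (blinfun_apply B h) h)" for t
    have near: "norm ((\<alpha> + t *\<^sub>R h) - \<alpha>) \<le> norm h" if "t \<in> {0..1}" for t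
      using that by (simp add: mult_left_le_one_le)
    have "norm (g 1 - g 0) \<le> C * norm h ^ n * norm h"
    proof (rule norm_increment_le[where g' = g'])
      fix t :: real assume t: "t \<in> {0..1}"
      have good_t: "(f has_derivative blinfun_apply (f' (\<alpha> + t *\<^sub>R h))) (at (\<alpha> + t *\<^sub>R h))"
        "norm (f' (\<alpha> + t *\<^sub>R h) - A - blinfun_apply B (t *\<^sub>R h)) \<le> C * norm (t *\<^sub>R h) ^ n"
        using good[of "\<alpha> + t *\<^sub>R h"] near[OF t] p by (auto simp: h_def)
      have "((\<lambda>t. f (\<alpha> + t *\<^sub>R h)) has_derivative
          (\<lambda>s. blinfun_apply (f' (\<alpha> + t *\<^sub>R h)) (s *\<^sub>R h))) (at t)"
        by (rule has_derivative_compose[where f = "\<lambda>t. \<alpha> + t *\<^sub>R h", OF _ good_t(1)])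
          (auto intro!: derivative_eq_intros)
      then have "((\<lambda>t. f (\<alpha> + t *\<^sub>R h)) has_vector_derivative
          blinfun_apply (f' (\<alpha> + t *\<^sub>R h)) h) (at t)"
        by (simp add: has_vector_derivative_def blinfun.scaleR_right)
      then show "(g has_vector_derivative g' t) (at t)"
        unfolding g_def g'_def
        by (intro has_vector_derivative_diff)
          (auto intro!: derivative_eq_intros simp: has_vector_derivative_def scaleR_add_right
            algebra_simps)
      have "g' t = blinfun_apply (f' (\<alpha> + t *\<^sub>R h) - A - blinfun_apply B (t *\<^sub>R h)) h"
        by (simp add: g'_def blinfun.bilinear_simps)
      then have "norm (g' t) \<le>
          norm (f' (\<alpha> + t *\<^sub>R h) - A - blinfun_apply B (t *\<^sub>R h)) * norm h"
        by (metis norm_blinfun)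
      also have "\<dots> \<le> (C * norm (t *\<^sub>R h) ^ n) * norm h"
        by (intro mult_right_mono good_t) simp
      also have "\<dots> \<le> (C * norm h ^ n) * norm h"
        using near[OF t] C(1) by (intro mult_right_mono mult_left_mono power_mono) auto
      finally show "norm (g' t) \<le> C * norm h ^ n * norm h" .
    qed
    then show "norm (f p - f \<alpha> - blinfun_apply A (p - \<alpha>)
         - (1/2) *\<^sub>R blinfun_apply (blinfun_apply B (p - \<alpha>)) (p - \<alpha>))
        \<le> C * norm (p - \<alpha>) ^ Suc n"
      by (simp add: g_def h_def algebra_simps)
  qed
qed

text \<open>This starts the chain of expansions: differentiability of $F'''$ at the single point $\alpha$
already makes its increment $O(\|p-\alpha\|)$.\<close>

lemma vanishes_increment:
  assumes "(f has_derivative blinfun_apply f') (at \<alpha>)"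
  shows "vanishes \<alpha> 1 (\<lambda>p. f p - f \<alpha>)"
proof (rule vanishesI)
  have "((\<lambda>p. norm (f p - f \<alpha> - blinfun_apply f' (p - \<alpha>)) / norm (p - \<alpha>)) \<longlongrightarrow> 0) (at \<alpha>)"
    using assms by (simp add: has_derivative_iff_norm)
  then have "\<forall>\<^sub>F p in at \<alpha>. norm (f p - f \<alpha> - blinfun_apply f' (p - \<alpha>)) / norm (p - \<alpha>) < 1"
    by (rule order_tendstoD) simp
  then have "\<forall>\<^sub>F p in nhds \<alpha>. p \<noteq> \<alpha> \<longrightarrow>
      norm (f p - f \<alpha> - blinfun_apply f' (p - \<alpha>)) / norm (p - \<alpha>) < 1"
    by (simp add: eventually_at_filter)
  then show "\<forall>\<^sub>F p in nhds \<alpha>. norm (f p - f \<alpha>) \<le> (1 + norm f') * norm (p - \<alpha>) ^ 1"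
  proof eventually_elim
    case (elim p)
    show ?case
    proof (cases "p = \<alpha>")
      case False
      then have "norm (f p - f \<alpha> - blinfun_apply f' (p - \<alpha>)) \<le> norm (p - \<alpha>)"
        using elim by (simp add: field_simps)
      moreover have "norm (blinfun_apply f' (p - \<alpha>)) \<le> norm f' * norm (p - \<alpha>)"
        by (rule norm_blinfun)
      ultimately show ?thesis
        using norm_triangle_sub[of "f p - f \<alpha>" "blinfun_apply f' (p - \<alpha>)"]
        by (simp add: algebra_simps)
    qed simp
  qed
qed

lemma has_derivative_fderiv:
  assumes "f differentiable (at x)"
  shows "(f has_derivative blinfun_apply (fderiv f x)) (at x)"
  using assms unfolding fderiv_def frechet_derivative_works
  by (simp add: bounded_linear_Blinfun_apply has_derivative_bounded_linear)

lemma jacobian_eq_fderiv: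
  assumes "f differentiable (at x)"
  shows "jacobian f (at x) = matrix_of_blinfun (fderiv f x)"
  using assms unfolding fderiv_def jacobian_def matrix_of_blinfun_def frechet_derivative_works
  by (simp add: bounded_linear_Blinfun_apply has_derivative_bounded_linear)


text \<open>The normalisation is that of the expansion $F'(\alpha+h) = L + 2Q(h) + 3T(h,h) + O(\|h\|^3)$, so that
$Q(u)v = L A_2(u,v)$ and $T(u,v)w = L A_3(u,v,w)$, where $L = F'(\alpha)$.\<close>

definition quadratic_part :: "(real^'m \<Rightarrow> real^'m) \<Rightarrow> real^'m \<Rightarrow> real^'m \<Rightarrow> real^'m^'m" where
  "quadratic_part F \<alpha> h = matrix_of_blinfun ((1/2) *\<^sub>R blinfun_apply (fderiv (fderiv F) \<alpha>) h)"

definition cubic_part ::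
    "(real^'m \<Rightarrow> real^'m) \<Rightarrow> real^'m \<Rightarrow> real^'m \<Rightarrow> real^'m \<Rightarrow> real^'m^'m" where
  "cubic_part F \<alpha> h k = matrix_of_blinfun
     ((1/6) *\<^sub>R blinfun_apply (blinfun_apply (fderiv (fderiv (fderiv F)) \<alpha>) h) k)"

lemma bounded_linear_quadratic_part: "bounded_linear (quadratic_part F \<alpha>)"
  unfolding quadratic_part_def
  by (intro bounded_linear_compose[OF bounded_linear_matrix_of_blinfun] bounded_linear_intros)

lemma bounded_bilinear_cubic_part: "bounded_bilinear (cubic_part F \<alpha>)"
  by (simp add: bilinear_conv_bounded_bilinear[symmetric] bilinear_def linear_iff cubic_part_def
      blinfun.bilinear_simps scaleR_add_right linear_simps[OF bounded_linear_matrix_of_blinfun])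

lemma A2_eq_quadratic_part:
  "A2 F \<alpha> u v = matrix_inv (jacobian F (at \<alpha>)) *v (quadratic_part F \<alpha> u *v v)"
  by (simp add: A2_def quadratic_part_def blinfun.scaleR_left matrix_vector_mult_scaleR fact_numeral)

lemma A3_eq_cubic_part:
  "A3 F \<alpha> u v w = matrix_inv (jacobian F (at \<alpha>)) *v (cubic_part F \<alpha> u v *v w)"
  by (simp add: A3_def cubic_part_def blinfun.scaleR_left matrix_vector_mult_scaleR fact_numeral)

text \<open>Three applications of the integration step: from $F'''$ to $F''$, from $F''$ to
$F'$, and from $F'$, truncated after its linear term, to $F$.\<close>

lemma taylor_C4:
  fixes F :: "real^'m \<Rightarrow> real^'m"
  assumes "open D" and C4: "C4_on D F" and "\<alpha> \<in> D"
  shows taylor_function: "vanishes \<alpha> 3 (\<lambda>p. F p - F \<alpha> - (jacobian F (at \<alpha>) *v (p - \<alpha>)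
          + quadratic_part F \<alpha> (p - \<alpha>) *v (p - \<alpha>)))"
    and taylor_jacobian: "vanishes \<alpha> 3 (\<lambda>p. jacobian F (at p) - (jacobian F (at \<alpha>)
          + 2 *\<^sub>R quadratic_part F \<alpha> (p - \<alpha>) + 3 *\<^sub>R cubic_part F \<alpha> (p - \<alpha>) (p - \<alpha>)))"
proof -
  have D: "\<forall>\<^sub>F p in nhds \<alpha>. p \<in> D"
    using assms by (simp add: eventually_nhds_in_open)
  have deriv:
    "p \<in> D \<Longrightarrow> (F has_derivative blinfun_apply (fderiv F p)) (at p)"
    "p \<in> D \<Longrightarrow> (fderiv F has_derivative blinfun_apply (fderiv (fderiv F) p)) (at p)"
    "p \<in> D \<Longrightarrow> (fderiv (fderiv F) has_derivative
        blinfun_apply (fderiv (fderiv (fderiv F)) p)) (at p)"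
    "p \<in> D \<Longrightarrow> (fderiv (fderiv (fderiv F)) has_derivative
        blinfun_apply (fderiv (fderiv (fderiv (fderiv F))) p)) (at p)" for p
    using C4 by (auto simp: C4_on_def intro: has_derivative_fderiv)
  have jac: "p \<in> D \<Longrightarrow> jacobian F (at p) = matrix_of_blinfun (fderiv F p)" for p
    using C4 by (auto simp: C4_on_def intro: jacobian_eq_fderiv)
  have third: "vanishes \<alpha> 1 (\<lambda>p. fderiv (fderiv (fderiv F)) p - fderiv (fderiv (fderiv F)) \<alpha>)"
    by (rule vanishes_increment[OF deriv(4)[OF assms(3)]])
  have second: "vanishes \<alpha> 2 (\<lambda>p. fderiv (fderiv F) p - fderiv (fderiv F) \<alpha>
      - blinfun_apply (fderiv (fderiv (fderiv F)) \<alpha>) (p - \<alpha>))"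
    using taylor_from_derivative[OF eventually_mono[OF D deriv(3)],
        where n = 1 and A = "fderiv (fderiv (fderiv F)) \<alpha>" and B = 0] third
    by (simp add: numeral_2_eq_2)
  have first: "vanishes \<alpha> 3 (\<lambda>p. fderiv F p - fderiv F \<alpha>
      - blinfun_apply (fderiv (fderiv F) \<alpha>) (p - \<alpha>)
      - (1/2) *\<^sub>R blinfun_apply (blinfun_apply (fderiv (fderiv (fderiv F)) \<alpha>) (p - \<alpha>)) (p - \<alpha>))"
    using taylor_from_derivative[OF eventually_mono[OF D deriv(2)] second]
    by (simp add: numeral_3_eq_3)
  have "vanishes \<alpha> 3 (\<lambda>p. matrix_of_blinfun (fderiv F p - fderiv F \<alpha>
      - blinfun_apply (fderiv (fderiv F) \<alpha>) (p - \<alpha>)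
      - (1/2) *\<^sub>R blinfun_apply (blinfun_apply (fderiv (fderiv (fderiv F)) \<alpha>) (p - \<alpha>)) (p - \<alpha>)))"
    by (rule vanishes_bounded_linear[OF bounded_linear_matrix_of_blinfun first])
  moreover have "\<forall>\<^sub>F p in nhds \<alpha>. matrix_of_blinfun (fderiv F p - fderiv F \<alpha>
      - blinfun_apply (fderiv (fderiv F) \<alpha>) (p - \<alpha>)
      - (1/2) *\<^sub>R blinfun_apply (blinfun_apply (fderiv (fderiv (fderiv F)) \<alpha>) (p - \<alpha>)) (p - \<alpha>))
      = jacobian F (at p) - (jacobian F (at \<alpha>)
          + 2 *\<^sub>R quadratic_part F \<alpha> (p - \<alpha>) + 3 *\<^sub>R cubic_part F \<alpha> (p - \<alpha>) (p - \<alpha>))"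
    using D
    by eventually_elim (simp add: jac assms(3) quadratic_part_def cubic_part_def
        linear_simps[OF bounded_linear_matrix_of_blinfun])
  ultimately show "vanishes \<alpha> 3 (\<lambda>p. jacobian F (at p) - (jacobian F (at \<alpha>)
          + 2 *\<^sub>R quadratic_part F \<alpha> (p - \<alpha>) + 3 *\<^sub>R cubic_part F \<alpha> (p - \<alpha>) (p - \<alpha>)))"
    by (rule vanishes_cong[rotated])
  have "vanishes \<alpha> 2 (\<lambda>p. (1/2) *\<^sub>R
      blinfun_apply (blinfun_apply (fderiv (fderiv (fderiv F)) \<alpha>) (p - \<alpha>)) (p - \<alpha>))"
    by (intro vanishes_scaleR vanishes_bilinear[OF bounded_bilinear_blinfun_apply, of _ 1 _ 1]
        vanishes_bounded_linear[OF blinfun.bounded_linear_right] vanishes_self) simp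
  from vanishes_add[OF vanishes_mono[OF first, of 2] this]
  have "vanishes \<alpha> 2 (\<lambda>p. fderiv F p - fderiv F \<alpha> - blinfun_apply (fderiv (fderiv F) \<alpha>) (p - \<alpha>))"
    by simp
  from taylor_from_derivative[OF eventually_mono[OF D deriv(1)] this]
  show "vanishes \<alpha> 3 (\<lambda>p. F p - F \<alpha> - (jacobian F (at \<alpha>) *v (p - \<alpha>)
          + quadratic_part F \<alpha> (p - \<alpha>) *v (p - \<alpha>)))"
    by (simp add: numeral_3_eq_3 jac assms(3) quadratic_part_def blinfun.scaleR_left diff_diff_eq add.assoc)
qed

section \<open>Expansion of divided differences\<close>

text \<open>Averaging a quadratic polynomial along a segment. For symmetric $T$ the terms in $T$ add up to
$T(p,p) + T(p,q) + T(q,q)$, the familiar form of the second-order term of a divided difference.\<close>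

lemma has_integral_quadratic_along_segment:
  fixes Q :: "'a::real_normed_vector \<Rightarrow> 'b::euclidean_space"
  assumes "bounded_linear Q" and "bounded_bilinear T"
  shows "((\<lambda>t::real. A + 2 *\<^sub>R Q (q + t *\<^sub>R (p - q))
            + 3 *\<^sub>R T (q + t *\<^sub>R (p - q)) (q + t *\<^sub>R (p - q)))
    has_integral A + Q (p + q) + T p p + T q q + (1/2) *\<^sub>R (T p q + T q p)) {0..1}"
proof -
  interpret Q: bounded_linear Q by fact
  interpret T: bounded_bilinear T by fact
  define c where "c = p - q"
  define g where "g t = t *\<^sub>R (A + 2 *\<^sub>R Q q + 3 *\<^sub>R T q q)
      + t\<^sup>2 *\<^sub>R (Q c + (3/2) *\<^sub>R (T q c + T c q)) + t ^ 3 *\<^sub>R T c c" for t :: real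
  have "((\<lambda>t. A + 2 *\<^sub>R Q (q + t *\<^sub>R c) + 3 *\<^sub>R T (q + t *\<^sub>R c) (q + t *\<^sub>R c))
      has_integral g 1 - g 0) {0..1}"
  proof (rule fundamental_theorem_of_calculus)
    fix t :: real
    have "(g has_vector_derivative (A + 2 *\<^sub>R Q q + 3 *\<^sub>R T q q)
        + (2 * t) *\<^sub>R (Q c + (3/2) *\<^sub>R (T q c + T c q)) + (3 * t\<^sup>2) *\<^sub>R T c c) (at t within {0..1})"
      unfolding g_def has_vector_derivative_def
      by (rule derivative_eq_intros refl)+ (simp add: fun_eq_iff scaleR_add_right mult_ac)
    then show "(g has_vector_derivative A + 2 *\<^sub>R Q (q + t *\<^sub>R c)
        + 3 *\<^sub>R T (q + t *\<^sub>R c) (q + t *\<^sub>R c)) (at t within {0..1})"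
      by (simp add: Q.add Q.scaleR T.add_left T.add_right T.scaleR_left T.scaleR_right
          scaleR_add_right power2_eq_square algebra_simps)
  qed simp
  moreover have "g 1 - g 0 = A + Q (p + q) + T p p + T q q + (1/2) *\<^sub>R (T p q + T q p)"
  proof -
    have p: "p = q + c" by (simp add: c_def)
    have pq: "T p q + T q p = 2 *\<^sub>R T q q + (T q c + T c q)"
      and pp: "T p p = T q q + (T q c + T c q) + T c c"
      by (simp_all add: p T.add_left T.add_right scaleR_2)
    have "Q (p + q) = 2 *\<^sub>R Q q + Q c"
      by (simp add: p Q.add scaleR_2)
    moreover have "3 *\<^sub>R T q q = T q q + T q q + T q q"
      using scaleR_add_left[of 1 2 "T q q"] by (simp add: scaleR_2)
    moreover have "(3/2) *\<^sub>R (T q c + T c q) = (T q c + T c q) + (1/2) *\<^sub>R (T q c + T c q)"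
      using scaleR_add_left[of 1 "1/2" "T q c + T c q"] by simp
    ultimately show ?thesis
      unfolding g_def pq pp by (simp add: scaleR_add_right)
  qed
  ultimately show ?thesis by (simp add: c_def)
qed


text \<open>The divided difference is the average of $F'$ over the segment from $v$ to $u$. If both ends are within
$O(\|x-\alpha\|)$ of $\alpha$, then so is the whole segment, and the cubic remainder of $F'$ is
inherited by the average.\<close>

lemma divdiff_expansion:
  fixes F :: "real^'m \<Rightarrow> real^'m"
  assumes "open D" and C4: "C4_on D F" and "\<alpha> \<in> D"
    and u: "vanishes \<alpha> 1 (\<lambda>x. u x - \<alpha>)" and v: "vanishes \<alpha> 1 (\<lambda>x. v x - \<alpha>)"
  shows "vanishes \<alpha> 3 (\<lambda>x. divdiff F (u x) (v x) - (jacobian F (at \<alpha>)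
      + quadratic_part F \<alpha> ((u x - \<alpha>) + (v x - \<alpha>))
      + cubic_part F \<alpha> (u x - \<alpha>) (u x - \<alpha>) + cubic_part F \<alpha> (v x - \<alpha>) (v x - \<alpha>)
      + (1/2) *\<^sub>R (cubic_part F \<alpha> (u x - \<alpha>) (v x - \<alpha>) + cubic_part F \<alpha> (v x - \<alpha>) (u x - \<alpha>))))"
    (is "vanishes \<alpha> 3 (\<lambda>x. ?R (u x) (v x))")
proof -
  define P where "P h = jacobian F (at \<alpha>) + 2 *\<^sub>R quadratic_part F \<alpha> h + 3 *\<^sub>R cubic_part F \<alpha> h h" for h
  obtain C where C: "C > 0" "\<forall>\<^sub>F p in nhds \<alpha>.
      norm (jacobian F (at p) - P (p - \<alpha>)) \<le> C * norm (p - \<alpha>) ^ 3"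
    using vanishesE[OF taylor_jacobian[OF assms(1-3)]] unfolding P_def .
  have "\<forall>\<^sub>F p in nhds \<alpha>. p \<in> D"
    using assms by (simp add: eventually_nhds_in_open)
  with C(2) have "\<forall>\<^sub>F p in nhds \<alpha>.
      p \<in> D \<and> norm (jacobian F (at p) - P (p - \<alpha>)) \<le> C * norm (p - \<alpha>) ^ 3"
    by eventually_elim simp
  then obtain r where r: "r > 0" and good: "\<And>p. norm (p - \<alpha>) < r \<Longrightarrow>
      p \<in> D \<and> norm (jacobian F (at p) - P (p - \<alpha>)) \<le> C * norm (p - \<alpha>) ^ 3"
    by (auto simp: eventually_nhds_metric dist_norm)
  have "continuous_on D (fderiv F)"
    using C4 unfolding C4_on_def
    by (meson continuous_at_imp_continuous_on differentiable_imp_continuous_within)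
  then have "continuous_on D (\<lambda>p. matrix_of_blinfun (fderiv F p))"
    by (rule bounded_linear.continuous_on[OF bounded_linear_matrix_of_blinfun])
  then have jac_cont: "continuous_on D (\<lambda>p. jacobian F (at p))"
    using C4 by (auto simp: C4_on_def jacobian_eq_fderiv cong: continuous_on_cong)
  have remainder: "norm (?R p q) \<le> C * (norm (p - \<alpha>) + norm (q - \<alpha>)) ^ 3"
    if p: "norm (p - \<alpha>) < r" and q: "norm (q - \<alpha>) < r" for p q
  proof -
    \<comment> \<open>the segment lies in the ball of validity, and its distance to the centre is controlled by its ends\<close>
    have segment: "norm (q + t *\<^sub>R (p - q) - \<alpha>) < r"
      "norm (q + t *\<^sub>R (p - q) - \<alpha>) \<le> norm (p - \<alpha>) + norm (q - \<alpha>)" if t: "t \<in> {0..1}" for t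
    proof -
      have "q + t *\<^sub>R (p - q) - \<alpha> = (1 - t) *\<^sub>R (q - \<alpha>) + t *\<^sub>R (p - \<alpha>)"
        by (simp add: algebra_simps)
      then have *: "norm (q + t *\<^sub>R (p - q) - \<alpha>) \<le> (1 - t) * norm (q - \<alpha>) + t * norm (p - \<alpha>)"
        using t norm_triangle_ineq[of "(1 - t) *\<^sub>R (q - \<alpha>)" "t *\<^sub>R (p - \<alpha>)"] by simp
      have "(1 - t) * norm (q - \<alpha>) + t * norm (p - \<alpha>) \<le> norm (q - \<alpha>) + norm (p - \<alpha>)"
        using t by (intro add_mono mult_left_le_one_le) auto
      with * show "norm (q + t *\<^sub>R (p - q) - \<alpha>) \<le> norm (p - \<alpha>) + norm (q - \<alpha>)" by simp
      have "(1 - t) * norm (q - \<alpha>) + t * norm (p - \<alpha>) < r"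
        using t p q by (intro convex_bound_lt) auto
      with * show "norm (q + t *\<^sub>R (p - q) - \<alpha>) < r" by simp
    qed
    let ?J = "\<lambda>t. jacobian F (at (q + t *\<^sub>R (p - q)))"
    have "continuous_on {0..1} ?J"
      using good segment(1)
      by (intro continuous_on_compose2[OF jac_cont] continuous_intros) blast
    then have "(?J has_integral divdiff F p q) {0..1}"
      unfolding divdiff_def by (intro integrable_integral integrable_continuous_interval)
    moreover have shift: "(q - \<alpha>) + t *\<^sub>R ((p - \<alpha>) - (q - \<alpha>)) = q + t *\<^sub>R (p - q) - \<alpha>" for t
      by simp
    have "((\<lambda>t. P (q + t *\<^sub>R (p - q) - \<alpha>)) has_integral (jacobian F (at \<alpha>)
      + quadratic_part F \<alpha> ((p - \<alpha>) + (q - \<alpha>))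
      + cubic_part F \<alpha> (p - \<alpha>) (p - \<alpha>) + cubic_part F \<alpha> (q - \<alpha>) (q - \<alpha>)
      + (1/2) *\<^sub>R (cubic_part F \<alpha> (p - \<alpha>) (q - \<alpha>) + cubic_part F \<alpha> (q - \<alpha>) (p - \<alpha>)))) {0..1}"
      unfolding P_def
      using has_integral_quadratic_along_segment[OF bounded_linear_quadratic_part
          bounded_bilinear_cubic_part, of "jacobian F (at \<alpha>)" F \<alpha> "q - \<alpha>" "p - \<alpha>"]
      by (simp only: shift)
    ultimately have "((\<lambda>t. ?J t - P (q + t *\<^sub>R (p - q) - \<alpha>)) has_integral ?R p q) {0..1}"
      by (rule has_integral_diff)
    then have "((\<lambda>t. ?J t - P (q + t *\<^sub>R (p - q) - \<alpha>)) has_integral ?R p q) (cbox 0 1)"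
      by simp
    moreover have "norm (?J t - P (q + t *\<^sub>R (p - q) - \<alpha>))
        \<le> C * (norm (p - \<alpha>) + norm (q - \<alpha>)) ^ 3" if "t \<in> cbox 0 1" for t
    proof -
      have t: "t \<in> {0..1}" using that by simp
      have "norm (?J t - P (q + t *\<^sub>R (p - q) - \<alpha>)) \<le> C * norm (q + t *\<^sub>R (p - q) - \<alpha>) ^ 3"
        using good segment(1)[OF t] by blast
      also have "\<dots> \<le> C * (norm (p - \<alpha>) + norm (q - \<alpha>)) ^ 3"
        using segment(2)[OF t] C(1) by (intro mult_left_mono power_mono) auto
      finally show ?thesis .
    qed
    ultimately have "norm (?R p q) \<le> C * (norm (p - \<alpha>) + norm (q - \<alpha>)) ^ 3
        * measure lborel (cbox 0 (1::real))"
      using C(1) by (intro has_integral_bound) auto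
    then show ?thesis by simp
  qed
  obtain U where U: "\<forall>\<^sub>F x in nhds \<alpha>. norm (u x - \<alpha>) \<le> U * norm (x - \<alpha>) ^ 1"
    using vanishesE[OF u] .
  obtain V where V: "\<forall>\<^sub>F x in nhds \<alpha>. norm (v x - \<alpha>) \<le> V * norm (x - \<alpha>) ^ 1"
    using vanishesE[OF v] .
  have "\<forall>\<^sub>F x in nhds \<alpha>. norm (u x - \<alpha>) < r" "\<forall>\<^sub>F x in nhds \<alpha>. norm (v x - \<alpha>) < r"
    using tendstoD[OF vanishes_imp_tendsto[OF u] r] tendstoD[OF vanishes_imp_tendsto[OF v] r]
    by simp_all
  with U V have "\<forall>\<^sub>F x in nhds \<alpha>. norm (?R (u x) (v x)) \<le> (C * (U + V) ^ 3) * norm (x - \<alpha>) ^ 3"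
  proof eventually_elim
    case (elim x)
    have "norm (?R (u x) (v x)) \<le> C * (norm (u x - \<alpha>) + norm (v x - \<alpha>)) ^ 3"
      by (intro remainder elim)
    also have "\<dots> \<le> C * ((U + V) * norm (x - \<alpha>)) ^ 3"
      using elim C(1) by (intro mult_left_mono power_mono) (auto simp: algebra_simps)
    finally show ?case by (simp add: power_mult_distrib mult_ac)
  qed
  then show ?thesis by (rule vanishesI)
qed

section \<open>The three substeps\<close>

lemmas matrix_vector_bilinear =
  bounded_bilinear.add_left[OF bounded_bilinear_matrix_vector_mult]
  bounded_bilinear.add_right[OF bounded_bilinear_matrix_vector_mult]
  bounded_bilinear.diff_left[OF bounded_bilinear_matrix_vector_mult]
  bounded_bilinear.diff_right[OF bounded_bilinear_matrix_vector_mult]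
  bounded_bilinear.scaleR_left[OF bounded_bilinear_matrix_vector_mult]
  bounded_bilinear.scaleR_right[OF bounded_bilinear_matrix_vector_mult]

locale simple_zero =
  fixes D :: "(real^'m) set" and F :: "real^'m \<Rightarrow> real^'m" and \<alpha> :: "real^'m"
  assumes open_D: "open D" and C4: "C4_on D F" and \<alpha>_in_D: "\<alpha> \<in> D"
    and zero: "F \<alpha> = 0" and invertible_jacobian: "invertible (jacobian F (at \<alpha>))"
begin

abbreviation L :: "real^'m^'m" where "L \<equiv> jacobian F (at \<alpha>)"
abbreviation Q :: "real^'m \<Rightarrow> real^'m^'m" where "Q \<equiv> quadratic_part F \<alpha>"
abbreviation T :: "real^'m \<Rightarrow> real^'m \<Rightarrow> real^'m^'m" where "T \<equiv> cubic_part F \<alpha>"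

abbreviation step_B :: "real^'m \<Rightarrow> real^'m^'m" where
  "step_B x \<equiv> divdiff F (x + F x) (x - F x)"

text \<open>The leading parts of the errors of the three substeps: $a = A_2(e,e)$ for $y$, $w$ for $z$, and the
vectorial error of $X$. The leading part of $M - L$ is
$K = 2Q(a) - T(e,e) - T(\widetilde e,\widetilde e)$. Multiplied by $L$, the error terms become
$La = Q(e)e$, $Lw = Ka - Q(a)a$ and $LX_{err} = Kw$, in which no inverse is left.\<close>

definition y_error :: "real^'m \<Rightarrow> real^'m" where
  "y_error x = A2 F \<alpha> (x - \<alpha>) (x - \<alpha>)"

definition M_correction :: "real^'m \<Rightarrow> real^'m^'m" where
  "M_correction x = 2 *\<^sub>R Q (y_error x) - T (x - \<alpha>) (x - \<alpha>) - T (L *v (x - \<alpha>)) (L *v (x - \<alpha>))"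

definition z_error :: "real^'m \<Rightarrow> real^'m" where
  "z_error x = A2 F \<alpha> (y_error x) (y_error x) - A3 F \<alpha> (x - \<alpha>) (x - \<alpha>) (y_error x)
     - A3 F \<alpha> (L *v (x - \<alpha>)) (L *v (x - \<alpha>)) (y_error x)"

definition X_error :: "real^'m \<Rightarrow> real^'m" where
  "X_error x = 2 *\<^sub>R A2 F \<alpha> (y_error x) (z_error x) - A3 F \<alpha> (x - \<alpha>) (x - \<alpha>) (z_error x)
     - A3 F \<alpha> (L *v (x - \<alpha>)) (L *v (x - \<alpha>)) (z_error x)"

lemma L_y_error: "L *v y_error x = Q (x - \<alpha>) *v (x - \<alpha>)"
  by (simp add: y_error_def A2_eq_quadratic_part matrix_inv_inverse(1) invertible_jacobian)

lemma L_z_error: "L *v z_error x = M_correction x *v y_error x - Q (y_error x) *v y_error x"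
  unfolding z_error_def M_correction_def A2_eq_quadratic_part A3_eq_cubic_part
    matrix_vector_bilinear matrix_inv_inverse(1)[OF invertible_jacobian]
  by (simp add: vec_eq_iff)

lemma L_X_error: "L *v X_error x = M_correction x *v z_error x"
  unfolding X_error_def M_correction_def A2_eq_quadratic_part A3_eq_cubic_part
    matrix_vector_bilinear matrix_inv_inverse(1)[OF invertible_jacobian] ..

lemmas vanishes_matrix_vector = vanishes_bilinear[OF bounded_bilinear_matrix_vector_mult]
lemmas vanishes_T = vanishes_bilinear[OF bounded_bilinear_cubic_part]

lemma vanishes_Q: "vanishes \<alpha> n f \<Longrightarrow> vanishes \<alpha> n (\<lambda>x. Q (f x))"
  by (rule vanishes_bounded_linear[OF bounded_linear_quadratic_part])

lemma vanishes_const_matrix: "vanishes \<alpha> n f \<Longrightarrow> vanishes \<alpha> n (\<lambda>x. (A::real^'m^'m) *v f x)"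
  by (rule vanishes_bounded_linear[OF matrix_vector_mul_bounded_linear])

lemma vanishes_Le: "vanishes \<alpha> 1 (\<lambda>x. L *v (x - \<alpha>))"
  by (intro vanishes_const_matrix vanishes_self)

lemma y_error_order: "vanishes \<alpha> 2 y_error"
  unfolding y_error_def[abs_def] A2_eq_quadratic_part
  by (intro vanishes_const_matrix vanishes_matrix_vector[where m = 1 and n = 1]
      vanishes_Q vanishes_self) simp

lemma M_correction_order: "vanishes \<alpha> 2 M_correction"
  unfolding M_correction_def[abs_def]
  by (intro vanishes_diff vanishes_scaleR vanishes_Q y_error_order
      vanishes_T[where m = 1 and n = 1] vanishes_self vanishes_Le) simp_all

lemma z_error_order: "vanishes \<alpha> 4 z_error"
proof -
  have "vanishes \<alpha> 4 (\<lambda>x. matrix_inv L *v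
      (M_correction x *v y_error x - Q (y_error x) *v y_error x))"
    by (intro vanishes_const_matrix vanishes_diff vanishes_matrix_vector[where m = 2 and n = 2]
        vanishes_Q y_error_order M_correction_order) simp_all
  then show ?thesis by (simp flip: L_z_error add: matrix_inv_inverse(2) invertible_jacobian)
qed

lemma X_error_order: "vanishes \<alpha> 6 X_error"
proof -
  have "vanishes \<alpha> 6 (\<lambda>x. matrix_inv L *v (M_correction x *v z_error x))"
    by (intro vanishes_const_matrix vanishes_matrix_vector[where m = 2 and n = 4]
        z_error_order M_correction_order) simp_all
  then show ?thesis by (simp flip: L_X_error add: matrix_inv_inverse(2) invertible_jacobian)
qed

lemma F_expansion:
  assumes "vanishes \<alpha> k (\<lambda>x. p x - \<alpha>)" and "k \<ge> 1"
  shows "vanishes \<alpha> (k * 3) (\<lambda>x. F (p x) - (L *v (p x - \<alpha>) + Q (p x - \<alpha>) *v (p x - \<alpha>)))"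
  using vanishes_compose[OF taylor_function[OF open_D C4 \<alpha>_in_D] assms] zero by simp

lemma F_linearization: "vanishes \<alpha> 2 (\<lambda>x. F x - L *v (x - \<alpha>))"
proof -
  have "vanishes \<alpha> 2 (\<lambda>x. (F x - (L *v (x - \<alpha>) + Q (x - \<alpha>) *v (x - \<alpha>)))
      + Q (x - \<alpha>) *v (x - \<alpha>))"
    using F_expansion[OF vanishes_self]
    by (intro vanishes_add vanishes_matrix_vector[where m = 1 and n = 1] vanishes_Q vanishes_self)
      (auto intro: vanishes_mono)
  then show ?thesis by simp
qed

lemma F_order: "vanishes \<alpha> 1 F"
  using vanishes_add[OF vanishes_mono[OF F_linearization, of 1] vanishes_Le] by simp

lemma eval_points_order:
  "vanishes \<alpha> 1 (\<lambda>x. x + F x - \<alpha>)" "vanishes \<alpha> 1 (\<lambda>x. x - F x - \<alpha>)"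
  using vanishes_add[OF vanishes_self F_order] vanishes_diff[OF vanishes_self F_order]
  by (simp_all add: algebra_simps)

text \<open>With arguments $e + f$ and $e - f$, $f = F(x)$, the terms linear in $f$ cancel: the sum of the
arguments is $2e$, and $T$ contributes $3T(e,e) + T(f,f)$. Replacing $f$ by $Le$ in $T(f,f)$
costs only third-order terms.\<close>

lemma B_expansion:
  "vanishes \<alpha> 3 (\<lambda>x. step_B x - (L + 2 *\<^sub>R Q (x - \<alpha>) + 3 *\<^sub>R T (x - \<alpha>) (x - \<alpha>)
      + T (L *v (x - \<alpha>)) (L *v (x - \<alpha>))))"
proof -
  interpret Q: bounded_linear Q by (rule bounded_linear_quadratic_part)
  interpret T: bounded_bilinear T by (rule bounded_bilinear_cubic_part)
  have "vanishes \<alpha> 3 (\<lambda>x. T (F x - L *v (x - \<alpha>)) (F x) + T (L *v (x - \<alpha>)) (F x - L *v (x - \<alpha>)))"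
    by (intro vanishes_add vanishes_T[OF F_linearization F_order]
        vanishes_T[OF vanishes_Le F_linearization]) simp_all
  from vanishes_add[OF divdiff_expansion[OF open_D C4 \<alpha>_in_D eval_points_order] this]
  have *: "vanishes \<alpha> 3 (\<lambda>x. step_B x - (L + Q ((x + F x - \<alpha>) + (x - F x - \<alpha>))
      + T (x + F x - \<alpha>) (x + F x - \<alpha>) + T (x - F x - \<alpha>) (x - F x - \<alpha>)
      + (1/2) *\<^sub>R (T (x + F x - \<alpha>) (x - F x - \<alpha>) + T (x - F x - \<alpha>) (x + F x - \<alpha>)))
      + (T (F x - L *v (x - \<alpha>)) (F x) + T (L *v (x - \<alpha>)) (F x - L *v (x - \<alpha>))))" .
  moreover have "L + Q ((x + F x - \<alpha>) + (x - F x - \<alpha>))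
      + T (x + F x - \<alpha>) (x + F x - \<alpha>) + T (x - F x - \<alpha>) (x - F x - \<alpha>)
      + (1/2) *\<^sub>R (T (x + F x - \<alpha>) (x - F x - \<alpha>) + T (x - F x - \<alpha>) (x + F x - \<alpha>))
      = L + 2 *\<^sub>R Q (x - \<alpha>) + 3 *\<^sub>R T (x - \<alpha>) (x - \<alpha>) + T (F x) (F x)" for x
  proof -
    define e f where "e = x - \<alpha>" and "f = F x"
    have ef: "x + F x - \<alpha> = e + f" "x - F x - \<alpha> = e - f" by (simp_all add: e_def f_def)
    have Qe: "Q ((e + f) + (e - f)) = 2 *\<^sub>R Q e"
      unfolding Q.add Q.diff by (simp add: vec_eq_iff)
    show ?thesis
      unfolding ef Qe unfolding e_def[symmetric] f_def[symmetric]
      by (simp add: T.add_left T.add_right T.diff_left T.diff_right vec_eq_iff field_simps)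
  qed
  moreover have "b - (c + T f f) + (T (f - g) f + T g (f - g)) = b - (c + T g g)" for b c f g
    by (simp add: T.diff_left T.diff_right)
  ultimately show ?thesis using * by (simp only:)
qed

lemma B_near_L: "vanishes \<alpha> 1 (\<lambda>x. step_B x - L)"
proof -
  have "vanishes \<alpha> 1 (\<lambda>x. (step_B x - (L + 2 *\<^sub>R Q (x - \<alpha>) + 3 *\<^sub>R T (x - \<alpha>) (x - \<alpha>)
      + T (L *v (x - \<alpha>)) (L *v (x - \<alpha>)))) + (2 *\<^sub>R Q (x - \<alpha>) + 3 *\<^sub>R T (x - \<alpha>) (x - \<alpha>)
      + T (L *v (x - \<alpha>)) (L *v (x - \<alpha>))))"
    by (intro vanishes_add vanishes_scaleR vanishes_Q vanishes_T[where m = 1 and n = 1]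
        vanishes_self vanishes_Le vanishes_mono[OF B_expansion]) simp_all
  then show ?thesis by (simp add: algebra_simps)
qed

text \<open>Since $B = L + 2Q(e) + O(\|e\|^2)$, the defect is $Be - F(x) = Q(e)e + O(\|e\|^3)$, which is
$La$ to third order.\<close>

lemma y_expansion: "vanishes \<alpha> 3 (\<lambda>x. step_y F x - \<alpha> - y_error x)"
  unfolding step_y_def
proof (rule newton_like_correction[OF invertible_jacobian B_near_L])
  let ?E = "\<lambda>x. 3 *\<^sub>R T (x - \<alpha>) (x - \<alpha>) + T (L *v (x - \<alpha>)) (L *v (x - \<alpha>))"
  have E: "vanishes \<alpha> 2 ?E"
    by (intro vanishes_add vanishes_scaleR vanishes_T[where m = 1 and n = 1]
        vanishes_self vanishes_Le) simp_all
  \<comment> \<open>the remainders of B and F, plus the part of B that is of second order in e\<close>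
  have "vanishes \<alpha> 3 (\<lambda>x.
      (step_B x - (L + 2 *\<^sub>R Q (x - \<alpha>) + 3 *\<^sub>R T (x - \<alpha>) (x - \<alpha>)
        + T (L *v (x - \<alpha>)) (L *v (x - \<alpha>)))) *v (x - \<alpha>)
      + ?E x *v (x - \<alpha>) - (F x - (L *v (x - \<alpha>) + Q (x - \<alpha>) *v (x - \<alpha>))))"
    by (rule vanishes_diff[OF vanishes_add[OF
          vanishes_matrix_vector[OF B_expansion vanishes_self]
          vanishes_matrix_vector[OF E vanishes_self]]
        vanishes_mono[OF F_expansion[OF vanishes_self]]]) simp_all
  moreover have "(step_B x - (L + 2 *\<^sub>R Q (x - \<alpha>) + 3 *\<^sub>R T (x - \<alpha>) (x - \<alpha>)
        + T (L *v (x - \<alpha>)) (L *v (x - \<alpha>)))) *v e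
      + ?E x *v e - (F x - (L *v e + Q (x - \<alpha>) *v e))
      = step_B x *v e - F x - Q (x - \<alpha>) *v e" for x e
    unfolding matrix_vector_bilinear by (simp add: vec_eq_iff)
  ultimately show "vanishes \<alpha> 3 (\<lambda>x. step_B x *v (x - \<alpha>) - F x - L *v y_error x)"
    by (simp only: L_y_error)
  show "vanishes \<alpha> 3 (\<lambda>x. (step_B x - L) *v y_error x)"
    by (rule vanishes_matrix_vector[OF B_near_L y_error_order]) simp
qed

lemma y_order: "vanishes \<alpha> 2 (\<lambda>x. step_y F x - \<alpha>)"
  using vanishes_add[OF vanishes_mono[OF y_expansion, of 2] y_error_order] by simp

text \<open>The point of the combination $2[y,x;F] - B$: the first-order term $2Q(e)$ of $B$ is cancelled by
the contribution of $x$ to $2[y,x;F]$. Only $2Q(y-\alpha)$, which is of second order, and the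
second-order terms in $T$ remain, so $M$ approximates $L$ one order better than $B$ does.\<close>

lemma M_expansion: "vanishes \<alpha> 3 (\<lambda>x. step_M F x - (L + M_correction x))"
proof -
  interpret Q: bounded_linear Q by (rule bounded_linear_quadratic_part)
  interpret T: bounded_bilinear T by (rule bounded_bilinear_cubic_part)
  let ?d = "\<lambda>x. step_y F x - \<alpha>" and ?e = "\<lambda>x. x - \<alpha>"
  \<comment> \<open>the remainders of both divided differences, plus the terms in which d and a differ or d occurs in T\<close>
  have "vanishes \<alpha> 3 (\<lambda>x. 2 *\<^sub>R (divdiff F (step_y F x) x
        - (L + Q (?d x + ?e x) + T (?d x) (?d x) + T (?e x) (?e x)
           + (1/2) *\<^sub>R (T (?d x) (?e x) + T (?e x) (?d x))))
      - (step_B x - (L + 2 *\<^sub>R Q (?e x) + 3 *\<^sub>R T (?e x) (?e x)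
           + T (L *v ?e x) (L *v ?e x)))
      + (2 *\<^sub>R Q (?d x - y_error x) + 2 *\<^sub>R T (?d x) (?d x) + T (?d x) (?e x) + T (?e x) (?d x)))"
    by (intro vanishes_add vanishes_diff vanishes_scaleR vanishes_Q y_expansion B_expansion
        divdiff_expansion[OF open_D C4 \<alpha>_in_D] vanishes_mono[OF y_order] vanishes_self
        vanishes_T[OF y_order y_order] vanishes_T[OF y_order vanishes_self]
        vanishes_T[OF vanishes_self y_order]) simp_all
  moreover have "2 *\<^sub>R (divdiff F (step_y F x) x
        - (L + Q (?d x + ?e x) + T (?d x) (?d x) + T (?e x) (?e x)
           + (1/2) *\<^sub>R (T (?d x) (?e x) + T (?e x) (?d x))))
      - (step_B x - (L + 2 *\<^sub>R Q (?e x) + 3 *\<^sub>R T (?e x) (?e x)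
           + T (L *v ?e x) (L *v ?e x)))
      + (2 *\<^sub>R Q (?d x - y_error x) + 2 *\<^sub>R T (?d x) (?d x) + T (?d x) (?e x) + T (?e x) (?d x))
      = step_M F x - (L + M_correction x)" for x
  proof -
    define e d where "e = x - \<alpha>" and "d = step_y F x - \<alpha>"
    show ?thesis
      unfolding step_M_def M_correction_def e_def[symmetric] d_def[symmetric]
      unfolding Q.add Q.diff
      by (simp add: vec_eq_iff field_simps)
  qed
  ultimately show ?thesis by (simp only:)
qed

lemma M_near_L: "vanishes \<alpha> 2 (\<lambda>x. step_M F x - L)"
  using vanishes_add[OF vanishes_mono[OF M_expansion, of 2] M_correction_order]
  by (simp add: algebra_simps)

text \<open>With $d = y - \alpha$, the defect is
$Md - F(y) = Kd - Q(d)d + O(\|e\|^5)$, and replacing $d$ by $a$, which is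
correct up to $O(\|e\|^3)$, turns it into $Ka - Q(a)a = Lw$.\<close>

lemma z_expansion: "vanishes \<alpha> 5 (\<lambda>x. step_z F x - \<alpha> - z_error x)"
  unfolding step_z_def step_nu_def
proof (rule newton_like_correction[OF invertible_jacobian])
  interpret Q: bounded_linear Q by (rule bounded_linear_quadratic_part)
  show "vanishes \<alpha> 1 (\<lambda>x. step_M F x - L)"
    by (rule vanishes_mono[OF M_near_L]) simp
  show "vanishes \<alpha> 5 (\<lambda>x. (step_M F x - L) *v z_error x)"
    by (rule vanishes_matrix_vector[OF M_near_L z_error_order]) simp
  let ?d = "\<lambda>x. step_y F x - \<alpha>"
  \<comment> \<open>the last two terms are the difference of Q(d)d and Q(a)a, with d - a as a factor\<close>
  have "vanishes \<alpha> 5 (\<lambda>x. (step_M F x - (L + M_correction x)) *v ?d x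
      + M_correction x *v (?d x - y_error x)
      - (F (step_y F x) - (L *v ?d x + Q (?d x) *v ?d x))
      - Q (?d x - y_error x) *v ?d x - Q (y_error x) *v (?d x - y_error x))"
    by (rule vanishes_diff[OF vanishes_diff[OF vanishes_diff[OF vanishes_add[OF
          vanishes_matrix_vector[OF M_expansion y_order]
          vanishes_matrix_vector[OF M_correction_order y_expansion]]
          vanishes_mono[OF F_expansion[OF y_order]]]
          vanishes_matrix_vector[OF vanishes_Q[OF y_expansion] y_order]]
          vanishes_matrix_vector[OF vanishes_Q[OF y_error_order] y_expansion]]) simp_all
  moreover have "(step_M F x - (L + M_correction x)) *v d
      + M_correction x *v (d - y_error x)
      - (F (step_y F x) - (L *v d + Q d *v d))
      - Q (d - y_error x) *v d - Q (y_error x) *v (d - y_error x)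
      = step_M F x *v d - F (step_y F x) - L *v z_error x" for x d
    unfolding L_z_error matrix_vector_bilinear Q.diff by (simp add: vec_eq_iff)
  ultimately show "vanishes \<alpha> 5 (\<lambda>x. step_M F x *v ?d x - F (step_y F x) - L *v z_error x)"
    by (simp only:)
qed

lemma z_order: "vanishes \<alpha> 4 (\<lambda>x. step_z F x - \<alpha>)"
  using vanishes_add[OF vanishes_mono[OF z_expansion, of 4] z_error_order] by simp

text \<open>Now the offset $z - \alpha$ is of order four, so that $Q(z-\alpha)(z-\alpha)$ is of order eight and
negligible: the defect is $K(z-\alpha)$, hence $Kw$, up to seventh order.\<close>

lemma X_expansion: "vanishes \<alpha> 7 (\<lambda>x. step_X F x - \<alpha> - X_error x)"
  unfolding step_X_def step_nu_def
proof (rule newton_like_correction[OF invertible_jacobian])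
  show "vanishes \<alpha> 1 (\<lambda>x. step_M F x - L)"
    by (rule vanishes_mono[OF M_near_L]) simp
  show "vanishes \<alpha> 7 (\<lambda>x. (step_M F x - L) *v X_error x)"
    by (rule vanishes_matrix_vector[OF M_near_L X_error_order]) simp
  let ?d = "\<lambda>x. step_z F x - \<alpha>"
  have "vanishes \<alpha> 7 (\<lambda>x. (step_M F x - (L + M_correction x)) *v ?d x
      + M_correction x *v (?d x - z_error x)
      - (F (step_z F x) - (L *v ?d x + Q (?d x) *v ?d x)) - Q (?d x) *v ?d x)"
    by (rule vanishes_diff[OF vanishes_diff[OF vanishes_add[OF
          vanishes_matrix_vector[OF M_expansion z_order]
          vanishes_matrix_vector[OF M_correction_order z_expansion]]
          vanishes_mono[OF F_expansion[OF z_order]]]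
          vanishes_matrix_vector[OF vanishes_Q[OF z_order] z_order]]) simp_all
  moreover have "(step_M F x - (L + M_correction x)) *v d
      + M_correction x *v (d - z_error x)
      - (F (step_z F x) - (L *v d + Q d *v d)) - Q d *v d
      = step_M F x *v d - F (step_z F x) - L *v X_error x" for x d
    unfolding L_X_error matrix_vector_bilinear by (simp add: vec_eq_iff)
  ultimately show "vanishes \<alpha> 7 (\<lambda>x. step_M F x *v ?d x - F (step_z F x) - L *v X_error x)"
    by (simp only:)
qed

lemma X_order: "vanishes \<alpha> 6 (\<lambda>x. step_X F x - \<alpha>)"
  using vanishes_add[OF vanishes_mono[OF X_expansion, of 6] X_error_order] by simp

lemma eventually_in_D:
  assumes "vanishes \<alpha> n (\<lambda>x. p x - \<alpha>)" and "n \<ge> 1"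
  shows "\<forall>\<^sub>F x in nhds \<alpha>. p x \<in> D"
proof -
  have "(p \<longlongrightarrow> \<alpha>) (nhds \<alpha>)"
    using vanishes_imp_tendsto[OF assms] by (simp add: LIM_zero_iff)
  then show ?thesis by (rule topological_tendstoD[OF _ open_D \<alpha>_in_D])
qed

lemma eventually_step_domain: "\<forall>\<^sub>F x in nhds \<alpha>. x \<in> step_domain D F"
  using eventually_in_D[OF vanishes_self] eventually_in_D[OF eval_points_order(1)]
    eventually_in_D[OF eval_points_order(2)] eventually_in_D[OF y_order] eventually_in_D[OF z_order]
    eventually_invertible[OF invertible_jacobian B_near_L]
    eventually_invertible[OF invertible_jacobian vanishes_mono[OF M_near_L]]
  by (simp add: step_domain_def eventually_conj_iff)

end

theorem theorem2p2:
  fixes D :: "(real^'m) set" and F :: "real^'m \<Rightarrow> real^'m" and \<alpha> :: "real^'m"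
  assumes "open D" and "convex D" and "C4_on D F"
    and "\<alpha> \<in> D" and "F \<alpha> = 0" and "invertible (jacobian F (at \<alpha>))"
  shows "local_order_at_least 6 (step_domain D F) (step_X F) \<alpha> \<and>
    (\<lambda>x. let e = x - \<alpha>;
             e' = jacobian F (at \<alpha>) *v e;
             w = A2 F \<alpha> (A2 F \<alpha> e e) (A2 F \<alpha> e e)
                 - A3 F \<alpha> e e (A2 F \<alpha> e e)
                 - A3 F \<alpha> e' e' (A2 F \<alpha> e e)
         in norm (step_X F x - \<alpha>
              - (2 *\<^sub>R A2 F \<alpha> (A2 F \<alpha> e e) w - A3 F \<alpha> e e w - A3 F \<alpha> e' e' w)))
      \<in> O[at \<alpha>](\<lambda>x. norm (x - \<alpha>) ^ 7)"
proof -
  interpret simple_zero D F \<alpha>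
    using assms by unfold_locales
  have "local_order_at_least 6 (step_domain D F) (step_X F) \<alpha>"
    by (rule local_order_if_vanishes[OF eventually_step_domain X_order]) simp
  moreover obtain C where "\<forall>\<^sub>F x in nhds \<alpha>.
      norm (step_X F x - \<alpha> - X_error x) \<le> C * norm (x - \<alpha>) ^ 7"
    using vanishesE[OF X_expansion] .
  then have "\<forall>\<^sub>F x in at \<alpha>. norm (step_X F x - \<alpha> - X_error x) \<le> C * norm (x - \<alpha>) ^ 7"
    by (auto simp: eventually_at_filter elim: eventually_mono)
  then have "(\<lambda>x. norm (step_X F x - \<alpha> - X_error x)) \<in> O[at \<alpha>](\<lambda>x. norm (x - \<alpha>) ^ 7)"
    by (intro bigoI[of _ C]) simp
  ultimately show ?thesis
    by (simp add: Let_def X_error_def z_error_def y_error_def)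
qed

end
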